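(* Let $\ell\ge 0$ be an integer, let $(x_i)_{i\ge0}$ be a sequence of nonnegative real numbers with $\sum_{i=0}^\infty x_i=1$ and $x_0>0$, and put $y_m=\sum_{j=m}^\infty x_j$. Let $w$ be the invariant measure of the Unbounded Multivariate Juggling Markov Chain on $\mathrm{St}^{(\ell)}$ given by $w(B)=\prod_{i\ge 1,\ b_i=\bullet}y_{E_i(B)}$ for $B=b_1b_2\cdots$, where $E_i(B)=\#\{j<i:b_j=\circ\}$. Then $w$ is finite if and only if $$\sum_{i=0}^\infty i\,x_i<\infty,$$ in which case its total mass is $$Z^{(\ell)}=h_\ell(y_0,y_1,\dots),$$ where $h_\ell$ is the complete homogeneous symmetric function of degree $\ell$, i.e. $h_\ell(y_0,y_1,\dots)=\sum_{0\le i_1\le\cdots\le i_\ell}y_{i_1}\cdots y_{i_\ell}$.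
   Context: $\mathrm{St}^{(\ell)}$ is the set of infinite words $a_1a_2a_3\cdots$ on the alphabet $\{\bullet,\circ\}$ (indexed by the positive integers) containing exactly $\ell$ occurrences of $\bullet$. For $A\in \mathrm{St}^{(\ell-1)}$ and $i\ge 0$ an integer, $T_i(A)\in \mathrm{St}^{(\ell)}$ is the word obtained by replacing the $(i+1)$-th occurrence of $\circ$ in $A$ (from the left) by $\bullet$. The Unbounded Multivariate Juggling Markov Chain (UMJMC) is the Markov chain on $\mathrm{St}^{(\ell)}$ whose transition probability from $A=a_1a_2a_3\cdots$ to $B$ is $$P_{A,B}=\begin{cases}1&\text{if } a_1=\circ\text{ and }B=a_2a_3\cdots,\\ x_i&\text{if }a_1=\bullet\text{ and }B=T_i(a_2a_3\cdots)\text{ for some } i\ge 0,\\ 0&\text{otherwise.}\end{cases}$$ The measure $w$ is known to be invariant for this chain, and it is the unique invariant measure up to a constant of proportionality.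
   Formalization: The equivalence is stated as "w is finite iff ℓ = 0 or Σ i x_i < ∞", because for ℓ = 0 the set St^(0) is a single word of weight 1, so w is finite even when Σ i x_i diverges; the mass formula is kept for all ℓ ≥ 0. *)

theory Defs
  imports "HOL-Analysis.Analysis"
begin

datatype site = Bullet | Circ

text \<open>A word \<open>a\<^sub>1 a\<^sub>2 a\<^sub>3 \<dots>\<close> is a function on \<^typ>\<open>nat\<close> whose value at \<open>n\<close> is the
  letter \<open>a\<^sub>n\<^sub>+\<^sub>1\<close>.\<close>

type_synonym word = "nat \<Rightarrow> site"

definition bullets :: "word \<Rightarrow> nat set" where
  "bullets A = {n. A n = Bullet}"

definition St :: "nat \<Rightarrow> word set" where
  "St l = {A. finite (bullets A) \<and> card (bullets A) = l}"

definition tail :: "word \<Rightarrow> word" where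
  "tail A = (\<lambda>n. A (Suc n))"

text \<open>\<^term>\<open>enumerate S i\<close> is the \<open>(i+1)\<close>-th smallest element of the infinite set \<open>S\<close>.\<close>

definition T :: "nat \<Rightarrow> word \<Rightarrow> word" where
  "T i A = A(enumerate {n. A n = Circ} i := Bullet)"

text \<open>On words with finitely many bullets the index \<open>i\<close> with \<open>B = T i (tail A)\<close> is unique
  when it exists.\<close>

definition umjmc :: "(nat \<Rightarrow> real) \<Rightarrow> word \<Rightarrow> word \<Rightarrow> real" where
  "umjmc x A B =
    (if A 0 = Circ \<and> B = tail A then 1
     else if A 0 = Bullet \<and> (\<exists>i. B = T i (tail A)) then x (THE i. B = T i (tail A))
     else 0)"

definition invariant_weight :: "'a set \<Rightarrow> ('a \<Rightarrow> 'a \<Rightarrow> real) \<Rightarrow> ('a \<Rightarrow> real) \<Rightarrow> bool" where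
  "invariant_weight S P f \<longleftrightarrow>
    (\<forall>A\<in>S. f A \<ge> 0) \<and> (\<forall>B\<in>S. ((\<lambda>A. f A * P A B) has_sum f B) S)"

definition tail_sum :: "(nat \<Rightarrow> real) \<Rightarrow> nat \<Rightarrow> real" where
  "tail_sum x m = (\<Sum>j. x (m + j))"

definition E :: "nat \<Rightarrow> word \<Rightarrow> nat" where
  "E n B = card {j. j < n \<and> B j = Circ}"

definition weight :: "(nat \<Rightarrow> real) \<Rightarrow> word \<Rightarrow> real" where
  "weight x B = (\<Prod>n\<in>bullets B. tail_sum x (E n B))"

definition weight_measure :: "nat \<Rightarrow> (nat \<Rightarrow> real) \<Rightarrow> word measure" where
  "weight_measure l x = point_measure (St l) (\<lambda>B. ennreal (weight x B))"

text \<open>\<open>weakly_increasing l\<close> is the index set of \<open>h\<^sub>l\<close>: the sequences \<open>i\<^sub>1 \<le> \<dots> \<le> i\<^sub>l\<close>.\<close>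

definition weakly_increasing :: "nat \<Rightarrow> nat list set" where
  "weakly_increasing l = {is. length is = l \<and> sorted is}"

definition complete_homogeneous :: "nat \<Rightarrow> (nat \<Rightarrow> real) \<Rightarrow> real" where
  "complete_homogeneous l v = (\<Sum>\<^sub>\<infinity>is\<in>weakly_increasing l. \<Prod>i\<leftarrow>is. v i)"


subsection \<open>Invariance of the weight\<close>

definition cons :: "site \<Rightarrow> word \<Rightarrow> word" where
  "cons s A = case_nat s A"

lemma cons_simps [simp]: "cons s A 0 = s" "cons s A (Suc n) = A n" "tail (cons s A) = A"
  by (auto simp: cons_def tail_def)

lemma cons_tail: "cons (A 0) (tail A) = A"
  by (rule ext) (auto simp: cons_def tail_def split: nat.splits)

lemma bullets_cons_Circ: "bullets (cons Circ B) = Suc ` bullets B"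
proof (rule set_eqI)
  show "n \<in> bullets (cons Circ B) \<longleftrightarrow> n \<in> Suc ` bullets B" for n
    by (cases n) (auto simp: bullets_def)
qed

lemma bullets_cons_Bullet: "bullets (cons Bullet B) = insert 0 (Suc ` bullets B)"
proof (rule set_eqI)
  show "n \<in> bullets (cons Bullet B) \<longleftrightarrow> n \<in> insert 0 (Suc ` bullets B)" for n
    by (cases n) (auto simp: bullets_def)
qed

lemma E_cons: "E (Suc n) (cons s B) = (if s = Circ then Suc (E n B) else E n B)"
proof -
  have "{j. j < Suc n \<and> cons s B j = Circ} =
      (if s = Circ then insert 0 (Suc ` {j. j < n \<and> B j = Circ}) else Suc ` {j. j < n \<and> B j = Circ})"
    (is "?L = ?R")
  proof (rule set_eqI)
    show "j \<in> ?L \<longleftrightarrow> j \<in> ?R" for j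
      by (cases j) auto
  qed
  then show ?thesis
    by (auto simp: E_def card_image card_insert_if)
qed

lemma E_0 [simp]: "E 0 B = 0"
  by (simp add: E_def)

lemma E_erase: "E n (B(p := Circ)) = (if p < n \<and> B p = Bullet then Suc (E n B) else E n B)"
proof -
  have "{j. j < n \<and> (B(p := Circ)) j = Circ} =
      (if p < n \<and> B p = Bullet then insert p {j. j < n \<and> B j = Circ} else {j. j < n \<and> B j = Circ})"
    by (auto split: if_splits) (metis site.exhaust)+
  then show ?thesis
    by (auto simp: E_def card_insert_if)
qed

lemma infinite_circs: "finite (bullets A) \<Longrightarrow> infinite {n. A n = Circ}"
proof
  assume "finite (bullets A)" "finite {n. A n = Circ}"
  then have "finite (bullets A \<union> {n. A n = Circ})" by simp
  moreover have "bullets A \<union> {n. A n = Circ} = UNIV"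
    using site.exhaust by (auto simp: bullets_def)
  ultimately show False by simp
qed

lemma enumerate_eq_iff:
  fixes S :: "nat set"
  assumes "infinite S" and "p \<in> S"
  shows "enumerate S i = p \<longleftrightarrow> i = card {j\<in>S. j < p}"
proof -
  have *: "card {j\<in>S. j < enumerate S i} = i" for i
  proof -
    have mono: "enumerate S k < enumerate S i \<longleftrightarrow> k < i" for k
      by (rule enumerate_mono_iff[OF assms(1)])
    have "{j\<in>S. j < enumerate S i} = enumerate S ` {..<i}"
    proof (intro equalityI subsetI)
      fix j assume j: "j \<in> {j\<in>S. j < enumerate S i}"
      then obtain k where "enumerate S k = j"
        using enumerate_Ex[of S j] assms(1) by blast
      then show "j \<in> enumerate S ` {..<i}"
        using j mono[of k] by auto
    next
      fix j assume "j \<in> enumerate S ` {..<i}"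
      then show "j \<in> {j\<in>S. j < enumerate S i}"
        using enumerate_in_set[OF assms(1)] mono by auto
    qed
    moreover have "inj (enumerate S)"
      using strict_mono_enumerate[OF assms(1)] by (rule strict_mono_imp_inj_on)
    ultimately show ?thesis by (simp add: card_image inj_on_subset[OF _ subset_UNIV])
  qed
  obtain k where k: "enumerate S k = p"
    using enumerate_Ex[of S p] assms by blast
  show ?thesis
    using *[of i] *[of k] k by auto
qed

lemma T_eq_iff:
  assumes "finite (bullets A)"
  shows "B = T i A \<longleftrightarrow> (\<exists>p\<in>bullets B. A = B(p := Circ) \<and> i = E p B)"
proof
  let ?S = "{n. A n = Circ}"
  have inf: "infinite ?S" by (rule infinite_circs[OF assms])
  {
    assume B: "B = T i A"
    define p where "p = enumerate ?S i"
    have pS: "p \<in> ?S" unfolding p_def by (rule enumerate_in_set[OF inf])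
    have "i = card {j\<in>?S. j < p}"
      using enumerate_eq_iff[OF inf pS] p_def by blast
    moreover have "{j\<in>?S. j < p} = {j. j < p \<and> B j = Circ}"
      using B by (auto simp: T_def p_def)
    ultimately have "i = E p B" by (simp add: E_def)
    moreover have "A = B(p := Circ)" "p \<in> bullets B"
      using B pS by (auto simp: T_def p_def bullets_def)
    ultimately show "\<exists>p\<in>bullets B. A = B(p := Circ) \<and> i = E p B" by blast
  next
    assume "\<exists>p\<in>bullets B. A = B(p := Circ) \<and> i = E p B"
    then obtain p where p: "p \<in> bullets B" "A = B(p := Circ)" "i = E p B" by blast
    have "p \<in> ?S" using p by simp
    moreover have "{j\<in>?S. j < p} = {j. j < p \<and> B j = Circ}"
      using p by auto
    ultimately have "enumerate ?S i = p"
      using enumerate_eq_iff[OF inf] p by (simp add: E_def)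
    then show "B = T i A"
      using p by (auto simp: T_def bullets_def)
  }
qed

lemma erase_inj: "B(p := Circ) = B(q := Circ) \<Longrightarrow> p \<in> bullets B \<Longrightarrow> q \<in> bullets B \<Longrightarrow> p = q"
  by (auto simp: bullets_def fun_eq_iff split: if_splits)

lemma prod_telescope:
  fixes a b :: "nat \<Rightarrow> real"
  assumes "finite D"
  shows "prod b D + (\<Sum>p\<in>D. (a p - b p) * (prod a {k\<in>D. k < p} * prod b {k\<in>D. p < k})) = prod a D"
  using assms
proof (induction D rule: finite_linorder_max_induct)
  case (insert m D)
  have m: "m \<notin> D" using insert by auto
  have top: "{k\<in>insert m D. k < m} = D" "{k\<in>insert m D. m < k} = {}" using insert by auto
  have "(\<Sum>p\<in>D. (a p - b p) * (prod a {k\<in>insert m D. k < p} * prod b {k\<in>insert m D. p < k})) =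
      (\<Sum>p\<in>D. (a p - b p) * (prod a {k\<in>D. k < p} * prod b {k\<in>D. p < k}) * b m)"
  proof (rule sum.cong)
    fix p assume "p \<in> D"
    then have "{k\<in>insert m D. k < p} = {k\<in>D. k < p}"
      "{k\<in>insert m D. p < k} = insert m {k\<in>D. p < k}" using insert by auto
    then show "(a p - b p) * (prod a {k\<in>insert m D. k < p} * prod b {k\<in>insert m D. p < k}) =
      (a p - b p) * (prod a {k\<in>D. k < p} * prod b {k\<in>D. p < k}) * b m"
      using insert m by simp
  qed simp
  also have "\<dots> = (prod a D - prod b D) * b m"
    unfolding sum_distrib_right[symmetric] by (subst insert.IH[symmetric]) simp
  finally have step: "(\<Sum>p\<in>D. (a p - b p) *
      (prod a {k\<in>insert m D. k < p} * prod b {k\<in>insert m D. p < k})) = (prod a D - prod b D) * b m" .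
  show ?case
    unfolding sum.insert[OF \<open>finite D\<close> m] prod.insert[OF \<open>finite D\<close> m] step top
    by (simp add: algebra_simps)
qed simp

lemma tail_sum_0: "x sums 1 \<Longrightarrow> tail_sum x 0 = 1"
  by (simp add: tail_sum_def sums_unique[symmetric])

lemma tail_sum_Suc: "x sums 1 \<Longrightarrow> tail_sum x m - tail_sum x (Suc m) = x m"
  using suminf_split_head[of "\<lambda>j. x (m + j)"]
  by (simp add: tail_sum_def sums_iff add.commute[of m] summable_ignore_initial_segment)

lemma tail_sum_nonneg: "(\<And>i. x i \<ge> 0) \<Longrightarrow> x sums 1 \<Longrightarrow> tail_sum x m \<ge> 0"
  by (auto simp: tail_sum_def sums_iff add.commute[of m] intro!: suminf_nonneg summable_ignore_initial_segment)

lemma weight_cons_Circ: "weight x (cons Circ B) = (\<Prod>n\<in>bullets B. tail_sum x (Suc (E n B)))"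
  by (simp add: weight_def bullets_cons_Circ prod.reindex E_cons)

lemma weight_cons_Bullet:
  assumes "x sums 1" "finite (bullets B)"
  shows "weight x (cons Bullet B) = weight x B"
proof -
  have "weight x (cons Bullet B) = tail_sum x 0 * (\<Prod>n\<in>Suc ` bullets B. tail_sum x (E n (cons Bullet B)))"
    unfolding weight_def bullets_cons_Bullet using assms(2) by (subst prod.insert) auto
  then show ?thesis
    using assms by (simp add: weight_def prod.reindex E_cons tail_sum_0)
qed

lemma bullets_erase: "bullets (B(p := Circ)) = bullets B - {p}"
  by (auto simp: bullets_def)

lemma weight_erase:
  assumes "finite (bullets B)" "p \<in> bullets B"
  shows "weight x (B(p := Circ)) = (\<Prod>n\<in>{k\<in>bullets B. k < p}. tail_sum x (E n B)) *
    (\<Prod>n\<in>{k\<in>bullets B. p < k}. tail_sum x (Suc (E n B)))"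
proof -
  have split: "bullets B - {p} = {k\<in>bullets B. k < p} \<union> {k\<in>bullets B. p < k}" by auto
  have "weight x (B(p := Circ)) =
     (\<Prod>n\<in>{k\<in>bullets B. k < p}. tail_sum x (E n (B(p := Circ)))) *
     (\<Prod>n\<in>{k\<in>bullets B. p < k}. tail_sum x (E n (B(p := Circ))))"
    unfolding weight_def bullets_erase split using assms(1) by (intro prod.union_disjoint) auto
  also have "\<dots> = (\<Prod>n\<in>{k\<in>bullets B. k < p}. tail_sum x (E n B)) *
    (\<Prod>n\<in>{k\<in>bullets B. p < k}. tail_sum x (Suc (E n B)))"
    using assms(2) by (intro arg_cong2[where f = "(*)"] prod.cong) (auto simp: E_erase bullets_def)
  finally show ?thesis .
qed

theorem weight_invariant:
  fixes x :: "nat \<Rightarrow> real"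
  assumes nonneg: "\<And>i. x i \<ge> 0" and sums: "x sums 1"
  shows "invariant_weight (St l) (umjmc x) (weight x)"
  unfolding invariant_weight_def
proof (intro conjI ballI)
  show "weight x A \<ge> 0" for A
    unfolding weight_def by (intro prod_nonneg) (auto intro: tail_sum_nonneg assms)
next
  fix B assume B: "B \<in> St l"
  define D where "D = bullets B"
  have D: "finite D" "card D = l" using B by (auto simp: St_def D_def)
  define g where "g p = cons Bullet (B(p := Circ))" for p
  define F where "F = insert (cons Circ B) (g ` D)"
  have fin_erase: "finite (bullets (B(p := Circ)))" for p
    using D by (simp add: bullets_erase D_def)
  have FS: "F \<subseteq> St l"
  proof
    fix A assume "A \<in> F"
    then consider "A = cons Circ B" | p where "p \<in> D" "A = g p" by (auto simp: F_def)
    then show "A \<in> St l"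
    proof cases
      case 1
      then show ?thesis using D by (simp add: St_def bullets_cons_Circ card_image D_def)
    next
      case 2
      then have "bullets A = insert 0 (Suc ` (D - {p}))"
        by (simp add: g_def bullets_cons_Bullet bullets_erase D_def)
      moreover have "l > 0" using 2 D by (auto simp: card_gt_0_iff)
      ultimately show ?thesis using 2 D
        by (simp add: St_def card_insert_if card_image image_iff card_Diff_singleton)
    qed
  qed
  have P_Circ: "umjmc x (cons Circ B) B = 1"
    by (simp add: umjmc_def)
  have P_g: "umjmc x (g p) B = x (E p B)" if p: "p \<in> D" for p
  proof -
    have eq: "B = T i (B(p := Circ)) \<longleftrightarrow> i = E p B" for i
      unfolding T_eq_iff[OF fin_erase] using p erase_inj[of B p] unfolding D_def by blast
    have "(THE i. B = T i (B(p := Circ))) = E p B"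
      unfolding eq by simp
    moreover have "\<exists>i. B = T i (B(p := Circ))"
      unfolding eq by simp
    ultimately show ?thesis unfolding umjmc_def g_def by simp
  qed
  have P_0: "umjmc x A B = 0" if A: "A \<in> St l - F" for A
  proof (rule ccontr)
    assume nz: "umjmc x A B \<noteq> 0"
    have fin: "finite (bullets (tail A))"
    proof -
      have "Suc ` bullets (tail A) \<subseteq> bullets A" by (auto simp: bullets_def tail_def)
      then have "finite (Suc ` bullets (tail A))" using A by (auto simp: St_def intro: finite_subset)
      then show ?thesis by (simp add: finite_image_iff)
    qed
    from nz consider "A 0 = Circ" "B = tail A" | i where "A 0 = Bullet" "B = T i (tail A)"
      by (auto simp: umjmc_def split: if_splits)
    then have "A \<in> F"
    proof cases
      case 1
      then show ?thesis using cons_tail[of A] by (simp add: F_def)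
    next
      case 2
      then obtain p where "p \<in> D" "tail A = B(p := Circ)"
        unfolding T_eq_iff[OF fin] D_def by blast
      then have "A = g p" using 2 cons_tail[of A] by (simp add: g_def)
      then show ?thesis using \<open>p \<in> D\<close> by (simp add: F_def)
    qed
    then show False using A by simp
  qed
  have inj: "inj_on g D"
    unfolding g_def using erase_inj[of B] D_def by (intro inj_onI) (metis cons_simps(3))
  have notin: "cons Circ B \<notin> g ` D"
    by (auto simp: g_def dest: fun_cong[where x = 0])
  have "(\<Sum>A\<in>F. weight x A * umjmc x A B) =
      weight x (cons Circ B) + (\<Sum>p\<in>D. weight x (g p) * x (E p B))"
    unfolding F_def using D notin inj by (simp add: sum.reindex P_Circ P_g)
  also have "\<dots> = (\<Prod>n\<in>D. tail_sum x (Suc (E n B))) +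
      (\<Sum>p\<in>D. (tail_sum x (E p B) - tail_sum x (Suc (E p B))) * ((\<Prod>n\<in>{k\<in>D. k < p}. tail_sum x (E n B)) *
        (\<Prod>n\<in>{k\<in>D. p < k}. tail_sum x (Suc (E n B)))))"
    using D sums
    by (simp add: g_def weight_cons_Bullet fin_erase weight_erase weight_cons_Circ tail_sum_Suc D_def mult.commute)
  also have "\<dots> = weight x B"
    unfolding weight_def D_def[symmetric] by (rule prod_telescope[OF D(1)])
  finally have "((\<lambda>A. weight x A * umjmc x A B) has_sum weight x B) F"
    using D by (metis F_def finite.insertI finite_imageI has_sum_finite)
  then show "((\<lambda>A. weight x A * umjmc x A B) has_sum weight x B) (St l)"
    by (rule has_sum_cong_neutral[THEN iffD1, rotated -1]) (use FS P_0 in auto)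
qed

end

(* Recording, for each bullet of a word, the number of circles to its left identifies the words with
   l bullets with the weakly increasing sequences of length l; the k-th bullet (counted from 0) is at
   position i_k + k. Under this bijection w becomes the general term of h_l, so w is finite iff h_l
   converges. Since y_0 = 1, the sequences (0, ..., 0, i) contribute the series of the y_i, while
   conversely h_l is dominated by the l-th power of that series. Finally, Abel summation compares
   the series of the y_i with the first moment of x. *)
theory Submission
  imports Defs
begin

text \<open>The total mass of a point measure is the integral of its density against counting
  measure on \<open>A\<close>. For nonnegative \<open>f\<close> that integral is finite exactly when
  \<open>f\<close> is absolutely summable, hence exactly when it is unconditionally
  summable.\<close>

lemma finite_measure_point_measure_iff:
  fixes f :: "'a \<Rightarrow> real"
  assumes "\<And>a. a \<in> A \<Longrightarrow> f a \<ge> 0"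
  shows "finite_measure (point_measure A (\<lambda>a. ennreal (f a))) \<longleftrightarrow> f summable_on A"
    and "f summable_on A \<Longrightarrow>
      emeasure (point_measure A (\<lambda>a. ennreal (f a))) (space (point_measure A (\<lambda>a. ennreal (f a)))) =
        ennreal (infsum f A)"
proof -
  let ?M = "point_measure A (\<lambda>a. ennreal (f a))"
  have mass: "emeasure ?M (space ?M) = (\<integral>\<^sup>+a. ennreal (f a) \<partial>count_space A)"
    unfolding point_measure_def by (auto simp: emeasure_density intro!: nn_integral_cong)
  have norm: "(\<integral>\<^sup>+a. ennreal (norm (f a)) \<partial>count_space A) = (\<integral>\<^sup>+a. ennreal (f a) \<partial>count_space A)"
    using assms by (intro nn_integral_cong) simp
  have "f summable_on A \<longleftrightarrow> Infinite_Set_Sum.abs_summable_on f A"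
    unfolding abs_summable_equivalent[symmetric]
    using assms by (intro summable_on_cong) simp
  also have "\<dots> \<longleftrightarrow> (\<integral>\<^sup>+a. ennreal (f a) \<partial>count_space A) < \<infinity>"
    unfolding Infinite_Set_Sum.abs_summable_on_def integrable_iff_bounded norm by simp
  also have "\<dots> \<longleftrightarrow> finite_measure ?M"
    unfolding mass[symmetric]
    by (metis finite_measureI finite_measure.emeasure_finite infinity_ennreal_def less_top)
  finally show "finite_measure ?M \<longleftrightarrow> f summable_on A" by blast
  assume "f summable_on A"
  then have "Infinite_Set_Sum.abs_summable_on f A"
    unfolding abs_summable_equivalent[symmetric]
    using assms by (subst summable_on_cong[where g = f]) auto
  then show "emeasure ?M (space ?M) = ennreal (infsum f A)"
    unfolding mass using assms by (simp add: nn_integral_conv_infsetsum infsetsum_infsum)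
qed

definition heights :: "word \<Rightarrow> nat list" where
  "heights B = map (\<lambda>n. E n B) (sorted_list_of_set (bullets B))"

lemma prod_list_heights:
  assumes "finite (bullets B)"
  shows "(\<Prod>i\<leftarrow>heights B. tail_sum x i) = weight x B"
  unfolding heights_def weight_def map_map comp_def
  using assms prod.distinct_set_conv_list[of "sorted_list_of_set (bullets B)" "\<lambda>n. tail_sum x (E n B)"]
  by simp

text \<open>Each of the \<open>n\<close> positions before \<open>n\<close> carries a circle or a
  bullet. At the \<open>k\<close>-th bullet the second summand is \<open>k\<close>, which links
  heights to positions.\<close>

lemma E_plus_card_bullets: "E n B + card {j\<in>bullets B. j < n} = n"
proof -
  have "{j. j < n \<and> B j = Circ} \<union> {j\<in>bullets B. j < n} = {..<n}"
    using site.exhaust by (auto simp: bullets_def)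
  moreover have "card ({j. j < n \<and> B j = Circ} \<union> {j\<in>bullets B. j < n}) =
      E n B + card {j\<in>bullets B. j < n}"
    unfolding E_def by (rule card_Un_disjoint) (auto simp: bullets_def)
  ultimately show ?thesis by simp
qed

lemma E_mono: "m \<le> n \<Longrightarrow> E m B \<le> E n B"
  unfolding E_def by (rule card_mono) auto

lemma card_below_nth:
  fixes ps :: "nat list"
  assumes "sorted_wrt (<) ps" "k < length ps"
  shows "card {j\<in>set ps. j < ps ! k} = k"
proof -
  have less: "ps ! i < ps ! j \<longleftrightarrow> i < j" if "i < length ps" "j < length ps" for i j
    using sorted_wrt_nth_less[OF assms(1)] that by (metis less_asym linorder_neqE_nat)
  have "{j\<in>set ps. j < ps ! k} = (\<lambda>i. ps ! i) ` {i. i < length ps \<and> ps ! i < ps ! k}"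
    by (auto simp: set_conv_nth)
  also have "{i. i < length ps \<and> ps ! i < ps ! k} = {..<k}"
    using assms(2) less[OF _ assms(2)] by auto
  finally have "{j\<in>set ps. j < ps ! k} = (\<lambda>i. ps ! i) ` {..<k}" .
  moreover have "inj_on (\<lambda>i. ps ! i) {..<k}"
    using assms(2) less by (intro inj_onI) (metis lessThan_iff less_irrefl less_trans linorder_neqE_nat)
  ultimately show ?thesis by (simp add: card_image)
qed

text \<open>Exactly \<open>k\<close> bullets precede \<open>ps ! k\<close>, so the remaining
  positions before it are circles. The additive form avoids truncated subtraction and lets positions
  be read off from heights, which serves both halves of the bijection.\<close>

lemma nth_heights:
  assumes "bullets B = set ps" "sorted_wrt (<) ps"
  shows "length (heights B) = length ps"
    and "k < length ps \<Longrightarrow> heights B ! k + k = ps ! k"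
proof -
  have ps: "sorted_list_of_set (bullets B) = ps"
    using assms by (metis List.finite_set strict_sorted_equal sorted_list_of_set.set_sorted_key_list_of_set
        sorted_list_of_set.strict_sorted_key_list_of_set)
  show "length (heights B) = length ps"
    by (simp add: heights_def ps)
  show "heights B ! k + k = ps ! k" if "k < length ps"
    using E_plus_card_bullets[of "ps ! k" B] card_below_nth[OF assms(2) that] that assms(1)
    by (simp add: heights_def ps[unfolded assms(1)])
qed

lemma bij_betw_heights: "bij_betw heights (St l) (weakly_increasing l)"
proof -
  have pos: "\<exists>ps. bullets B = set ps \<and> sorted_wrt (<) ps \<and> length ps = l" if "B \<in> St l" for B
    using that by (intro exI[of _ "sorted_list_of_set (bullets B)"]) (auto simp: St_def)
  have "heights B \<in> weakly_increasing l" if "B \<in> St l" for B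
  proof -
    have "sorted (heights B)"
      unfolding heights_def sorted_map
      by (rule sorted_wrt_mono_rel[OF _ sorted_sorted_list_of_set]) (auto intro: E_mono)
    then show ?thesis
      using that by (simp add: weakly_increasing_def heights_def St_def)
  qed
  moreover have "inj_on heights (St l)"
  proof (rule inj_onI)
    fix A B assume A: "A \<in> St l" and B: "B \<in> St l" and eq: "heights A = heights B"
    obtain ps qs where ps: "bullets A = set ps" "sorted_wrt (<) ps" "length ps = l"
      and qs: "bullets B = set qs" "sorted_wrt (<) qs" "length qs = l"
      using pos[OF A] pos[OF B] by blast
    \<comment> \<open>Both \<open>ps ! k\<close> and \<open>qs ! k\<close> equal the common
      \<open>k\<close>-th height plus \<open>k\<close>.\<close>
    have "ps = qs"
      using ps(3) qs(3) nth_heights(2)[OF ps(1,2)] nth_heights(2)[OF qs(1,2)] eq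
      by (intro nth_equalityI) auto
    then have "A n = Bullet \<longleftrightarrow> B n = Bullet" for n
      using ps(1) qs(1) by (auto simp: bullets_def)
    then show "A = B"
      by (metis ext site.exhaust)
  qed
  moreover have "is \<in> heights ` St l" if "is \<in> weakly_increasing l" for "is"
  proof -
    have len: "length is = l" and sorted: "sorted is"
      using that by (auto simp: weakly_increasing_def)
    \<comment> \<open>A bullet of height \<open>is ! k\<close> that is to be the \<open>k\<close>-th
      one has \<open>is ! k\<close> circles and \<open>k\<close> bullets before it, which forces its
      position. Adding the index turns the weakly increasing \<open>is\<close> into a strictly
      increasing list, so no two bullets collide.\<close>
    define ps where "ps = map (\<lambda>k. is ! k + k) [0..<l]"
    define B where "B n = (if n \<in> set ps then Bullet else Circ)" for n
    have B: "bullets B = set ps"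
      by (auto simp: bullets_def B_def)
    have ps: "sorted_wrt (<) ps"
      unfolding sorted_wrt_iff_nth_less using sorted_nth_mono[OF sorted] len
      by (auto simp: ps_def intro: add_le_less_mono)
    have "heights B = is"
      using nth_heights[OF B ps] len by (intro nth_equalityI) (auto simp: ps_def)
    moreover have "B \<in> St l"
      using ps B by (simp add: St_def strict_sorted_iff distinct_card) (simp add: ps_def)
    ultimately show ?thesis by blast
  qed
  ultimately show ?thesis
    by (auto simp: bij_betw_def)
qed

text \<open>Without the ordering constraint the index set is a Cartesian power, over which the sum
  factors into \<open>l\<close> copies of the series of \<open>v\<close>. The induction splits off
  the head of the list. Ordered lists form a subset, so this yields convergence of h_l.\<close>

lemma summable_on_prod_list:
  fixes v :: "nat \<Rightarrow> real"
  assumes nonneg: "\<And>i. v i \<ge> 0" and "summable v"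
  shows "(\<lambda>is. \<Prod>i\<leftarrow>is. v i) summable_on {is. length is = l}"
proof (induction l)
  case (Suc l)
  let ?L = "{is :: nat list. length is = l}"
  let ?c = "\<lambda>(i, is). i # is :: nat list"
  have v: "v summable_on UNIV"
    using assms by (simp add: summable_on_UNIV_nonneg_real_iff)
  \<comment> \<open>Tonelli for nonnegative terms: each inner sum is \<open>v i\<close> times a
    constant independent of \<open>i\<close>.\<close>
  have "(\<lambda>(i, is). v i * (\<Prod>j\<leftarrow>is. v j)) summable_on (SIGMA i:UNIV. ?L)"
  proof (rule summable_on_SigmaI)
    show "((\<lambda>is. case (i, is) of (i, is) \<Rightarrow> v i * (\<Prod>j\<leftarrow>is. v j)) has_sum
        v i * (\<Sum>\<^sub>\<infinity>is\<in>?L. \<Prod>j\<leftarrow>is. v j)) ?L" for i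
      using Suc by (simp add: has_sum_cmult_right)
    show "(\<lambda>i. v i * (\<Sum>\<^sub>\<infinity>is\<in>?L. \<Prod>j\<leftarrow>is. v j)) summable_on UNIV"
      using v by (rule summable_on_cmult_left)
    show "0 \<le> (case (i, is) of (i, is) \<Rightarrow> v i * (\<Prod>j\<leftarrow>is. v j))" for i "is"
      by (auto intro!: mult_nonneg_nonneg prod_list_nonneg nonneg)
  qed
  then have "((\<lambda>is. \<Prod>i\<leftarrow>is. v i) \<circ> ?c) summable_on (UNIV \<times> ?L)"
    by (simp add: comp_def case_prod_unfold)
  moreover have "inj_on ?c (UNIV \<times> ?L)"
    by (auto simp: inj_on_def)
  ultimately have "(\<lambda>is. \<Prod>i\<leftarrow>is. v i) summable_on (?c ` (UNIV \<times> ?L))"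
    by (simp add: summable_on_reindex)
  also have "?c ` (UNIV \<times> ?L) = {is. length is = Suc l}"
    by (auto simp: length_Suc_conv image_iff)
  finally show ?case .
qed simp

text \<open>For \<open>l = 0\<close> the only index is \<open>[]\<close>, so the sum converges for
  every \<open>v\<close>. For positive \<open>l\<close>, the normalisation \<open>v 0 = 1\<close>
  makes the series of \<open>v\<close> itself a subfamily of the terms.\<close>

lemma summable_on_weakly_increasing_iff:
  fixes v :: "nat \<Rightarrow> real"
  assumes nonneg: "\<And>i. v i \<ge> 0" and "v 0 = 1"
  shows "(\<lambda>is. \<Prod>i\<leftarrow>is. v i) summable_on weakly_increasing l \<longleftrightarrow> l = 0 \<or> summable v"
proof (intro iffI; (elim disjE)?)
  assume sum: "(\<lambda>is. \<Prod>i\<leftarrow>is. v i) summable_on weakly_increasing l"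
  show "l = 0 \<or> summable v"
  proof (cases l)
    case (Suc k)
    \<comment> \<open>The \<open>k\<close> leading zeros contribute the factor 1, so the product
      over \<open>g i\<close> is \<open>v i\<close>; zeros in front keep the list sorted.\<close>
    define g :: "nat \<Rightarrow> nat list" where "g i = replicate k 0 @ [i]" for i
    have "range g \<subseteq> weakly_increasing l"
      using Suc by (auto simp: g_def weakly_increasing_def sorted_append)
    with sum have "(\<lambda>is. \<Prod>i\<leftarrow>is. v i) summable_on range g"
      by (rule summable_on_subset_banach)
    moreover have "inj g"
      by (auto simp: g_def inj_on_def)
    ultimately have "((\<lambda>is. \<Prod>i\<leftarrow>is. v i) \<circ> g) summable_on UNIV"
      by (simp add: summable_on_reindex)
    moreover have "(\<lambda>is. \<Prod>i\<leftarrow>is. v i) \<circ> g = v"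
      using assms(2) by (auto simp: g_def)
    ultimately show ?thesis
      using nonneg by (simp add: summable_on_UNIV_nonneg_real_iff)
  qed simp
next
  assume "l = 0"
  then have "weakly_increasing l = {[]}" by (auto simp: weakly_increasing_def)
  then show "(\<lambda>is. \<Prod>i\<leftarrow>is. v i) summable_on weakly_increasing l" by simp
next
  assume "summable v"
  with nonneg have "(\<lambda>is. \<Prod>i\<leftarrow>is. v i) summable_on {is. length is = l}"
    by (rule summable_on_prod_list)
  then show "(\<lambda>is. \<Prod>i\<leftarrow>is. v i) summable_on weakly_increasing l"
    by (rule summable_on_subset_banach) (auto simp: weakly_increasing_def)
qed

text \<open>Abel summation: for \<open>i < n\<close> the term \<open>x i\<close> occurs in the tails
  0 to \<open>i\<close>, hence \<open>i + 1\<close> times; every later term occurs in all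
  \<open>n\<close> tails, which produces the boundary term.\<close>

lemma sum_tail_sum:
  assumes "x sums 1"
  shows "(\<Sum>m<n. tail_sum x m) = (\<Sum>i<n. (real i + 1) * x i) + real n * tail_sum x n"
proof (induction n)
  case (Suc n)
  show ?case
    \<comment> \<open>Writing \<open>x n\<close> as a difference of consecutive tails reduces the
      step to an identity in \<open>tail_sum x n\<close> and
      \<open>tail_sum x (Suc n)\<close>.\<close>
    unfolding sum.lessThan_Suc Suc tail_sum_Suc[OF assms, of n, symmetric]
    by (simp add: algebra_simps)
qed simp

text \<open>Only the boundary term of the Abel summation separates the two partial sums. It is
  nonnegative, which gives one direction; for the other it is bounded by a remainder of the moment
  series.\<close>

lemma summable_tail_sum_iff:
  assumes nonneg: "\<And>i. x i \<ge> 0" and sums: "x sums 1"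
  shows "summable (tail_sum x) \<longleftrightarrow> summable (\<lambda>i. real i * x i)"
proof
  assume y: "summable (tail_sum x)"
  show "summable (\<lambda>i. real i * x i)"
  proof (rule summableI_nonneg_bounded)
    fix n
    have "(\<Sum>i<n. real i * x i) \<le> (\<Sum>i<n. (real i + 1) * x i)"
      using nonneg by (intro sum_mono) (simp add: mult_right_mono)
    also have "\<dots> \<le> (\<Sum>m<n. tail_sum x m)"
      using tail_sum_nonneg[OF nonneg sums] by (simp add: sum_tail_sum[OF sums])
    also have "\<dots> \<le> suminf (tail_sum x)"
      using y tail_sum_nonneg[OF nonneg sums] by (intro sum_le_suminf) auto
    finally show "(\<Sum>i<n. real i * x i) \<le> suminf (tail_sum x)" .
  qed (use nonneg in auto)
next
  assume first: "summable (\<lambda>i. real i * x i)"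
  \<comment> \<open>The coefficient \<open>i + 1\<close> is the one from Abel summation; the extra
    copy of \<open>x\<close> is summable.\<close>
  let ?f = "\<lambda>i. (real i + 1) * x i"
  have x: "summable x" using sums by (rule sums_summable)
  have f: "summable ?f"
    using summable_add[OF first x] by (simp add: algebra_simps)
  show "summable (tail_sum x)"
  proof (rule summableI_nonneg_bounded)
    fix n
    \<comment> \<open>Since \<open>n\<close> is at most \<open>j + n + 1\<close>, the boundary term
      is at most the remainder of \<open>?f\<close> from index \<open>n\<close> on. Together with
      the partial sum below \<open>n\<close> this stays under the full sum of \<open>?f\<close>,
      uniformly in \<open>n\<close>.\<close>
    have "real n * tail_sum x n = (\<Sum>j. real n * x (j + n))"
      using summable_ignore_initial_segment[OF x, of n]
      by (simp add: tail_sum_def suminf_mult add.commute)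
    also have "\<dots> \<le> (\<Sum>j. ?f (j + n))"
    proof (rule suminf_le)
      show "real n * x (j + n) \<le> ?f (j + n)" for j
        using nonneg by (intro mult_right_mono) auto
    qed (use summable_ignore_initial_segment[OF x] summable_ignore_initial_segment[OF f]
        in \<open>auto intro: summable_mult\<close>)
    finally show "(\<Sum>m<n. tail_sum x m) \<le> suminf ?f"
      using suminf_split_initial_segment[OF f, of n] by (simp add: sum_tail_sum[OF sums])
  qed (rule tail_sum_nonneg[OF nonneg sums])
qed

text \<open>The case \<open>l = 0\<close> is separate: \<open>St 0\<close> holds only the all-circle
  word, of weight 1, so the measure is finite even when the first moment diverges. Summability is
  asserted beside the mass formula because \<open>infsum\<close> is 0 on non-summable families; with
  it, the value of h_l is a genuine sum.\<close>

theorem proposition3p5: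
  fixes l :: nat and x :: "nat \<Rightarrow> real"
  assumes "\<forall>i. 0 \<le> x i" and "x sums 1" and "0 < x 0"
  shows "(finite_measure (weight_measure l x) \<longleftrightarrow> l = 0 \<or> summable (\<lambda>i. real i * x i)) \<and>
    (finite_measure (weight_measure l x) \<longrightarrow>
      (\<lambda>is. \<Prod>i\<leftarrow>is. tail_sum x i) summable_on weakly_increasing l \<and>
      emeasure (weight_measure l x) (space (weight_measure l x)) =
        ennreal (complete_homogeneous l (tail_sum x)))"
proof -
  let ?p = "\<lambda>is. \<Prod>i\<leftarrow>is. tail_sum x i"
  have x: "0 \<le> x i" for i using assms(1) by simp
  have y: "0 \<le> tail_sum x i" for i by (rule tail_sum_nonneg[OF x assms(2)])
  have w: "0 \<le> weight x B" for B
    unfolding weight_def by (intro prod_nonneg ballI y)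
  have p: "?p (heights B) = weight x B" if "B \<in> St l" for B
    using that by (intro prod_list_heights) (simp add: St_def)
  have "weight x summable_on St l \<longleftrightarrow> (\<lambda>B. ?p (heights B)) summable_on St l"
    using p by (intro summable_on_cong) simp
  also have "\<dots> \<longleftrightarrow> ?p summable_on weakly_increasing l"
    by (rule summable_on_reindex_bij_betw[OF bij_betw_heights])
  finally have summable: "weight x summable_on St l \<longleftrightarrow> ?p summable_on weakly_increasing l" .
  \<comment> \<open>Reindexing along the bijection also covers the divergent case, where both sides
    take the default value 0.\<close>
  have "infsum (weight x) (St l) = (\<Sum>\<^sub>\<infinity>B\<in>St l. ?p (heights B))"
    using p by (intro infsum_cong) simp
  also have "\<dots> = complete_homogeneous l (tail_sum x)"
    unfolding complete_homogeneous_def by (rule infsum_reindex_bij_betw[OF bij_betw_heights])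
  finally have infsum: "infsum (weight x) (St l) = complete_homogeneous l (tail_sum x)" .
  have finite: "finite_measure (weight_measure l x) \<longleftrightarrow> weight x summable_on St l"
    unfolding weight_measure_def by (rule finite_measure_point_measure_iff(1)) (rule w)
  have mass: "emeasure (weight_measure l x) (space (weight_measure l x)) =
      ennreal (complete_homogeneous l (tail_sum x))" if "weight x summable_on St l"
    unfolding weight_measure_def infsum[symmetric]
    by (rule finite_measure_point_measure_iff(2)[where f = "weight x", OF w that])
  have iff: "weight x summable_on St l \<longleftrightarrow> l = 0 \<or> summable (\<lambda>i. real i * x i)"
    unfolding summable summable_tail_sum_iff[OF x assms(2), symmetric]
    by (rule summable_on_weakly_increasing_iff[where v = "tail_sum x", OF y tail_sum_0[OF assms(2)]])
  show ?thesis
    unfolding finite by (intro conjI impI iff) (simp_all add: summable mass)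
qed

end
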